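(* Let $P$ be a finite poset and let $s\in P$. Assume that for each $y\in P$, either $s\wedge y$ exists or $s\vee y$ exists in $P$. Assume that if $w,z\in P$, $w<z$, $s\wedge w$ does not exist but $s\wedge z$ does exist, then $z\wedge(w\vee s)$ exists in $P$. Then the order complex $\Delta(P)$ is non-evasive.
   Context: A simplicial complex is a down-set $\Sigma$ of a power set of a set (the empty set $\emptyset$ is allowed to be a member). Its vertex set is $V(\Sigma)=\{x\mid \{x\}\in\Sigma\}$. For $W\subseteq V$, $\Sigma|W=\{\sigma\in\Sigma\mid \sigma\subseteq W\}$. For $\sigma\in\Sigma$: $\mathrm{dl}_\Sigma(\sigma)=\Sigma|(V\setminus\sigma)$, $\mathrm{st}_\Sigma(\sigma)=\{\tau\in\Sigma\mid \sigma\cup\tau\in\Sigma\}$, $\mathrm{lk}_\Sigma(\sigma)=\mathrm{dl}_\Sigma(\sigma)\cap\mathrm{st}_\Sigma(\sigma)$; for a vertex $v$ write $\mathrm{dl}_\Sigma(v)$, $\mathrm{lk}_\Sigma(v)$ for $\sigma=\{v\}$. Non-evasiveness is defined by induction on $|V|$ (for $V$ finite): $\Sigma$ is non-evasive if for some $v\in V$, either $\Sigma=\{\emptyset,\{v\}\}$, or $|V|>1$ and both $\mathrm{dl}_\Sigma(v)$ and $\mathrm{lk}_\Sigma(v)$ are non-evasive. The order complex $\Delta(P)$ of a poset $P$ is the simplicial complex of all chains of $P$ (including $\emptyset$). *)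

theory Defs
  imports "HOL-Algebra.Lattice"
begin

definition abstract_complex :: "'a set set \<Rightarrow> bool" where
  "abstract_complex \<Sigma> \<longleftrightarrow> (\<forall>\<sigma>\<in>\<Sigma>. \<forall>\<tau>. \<tau> \<subseteq> \<sigma> \<longrightarrow> \<tau> \<in> \<Sigma>)"

definition vertices :: "'a set set \<Rightarrow> 'a set" where
  "vertices \<Sigma> = {x. {x} \<in> \<Sigma>}"

definition induced :: "'a set set \<Rightarrow> 'a set \<Rightarrow> 'a set set" where
  "induced \<Sigma> W = {\<sigma> \<in> \<Sigma>. \<sigma> \<subseteq> W}"

definition deletion :: "'a set set \<Rightarrow> 'a set \<Rightarrow> 'a set set" where
  "deletion \<Sigma> \<sigma> = induced \<Sigma> (vertices \<Sigma> - \<sigma>)"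

definition star :: "'a set set \<Rightarrow> 'a set \<Rightarrow> 'a set set" where
  "star \<Sigma> \<sigma> = {\<tau> \<in> \<Sigma>. \<sigma> \<union> \<tau> \<in> \<Sigma>}"

definition link :: "'a set set \<Rightarrow> 'a set \<Rightarrow> 'a set set" where
  "link \<Sigma> \<sigma> = deletion \<Sigma> \<sigma> \<inter> star \<Sigma> \<sigma>"

(* The recursion is on the number of vertices: the deletion and the link of a
   vertex v do not have v as a vertex, so every derivation follows the induction
   on the cardinality of the vertex set.  Neither {} nor {{}} is non-evasive. *)
inductive non_evasive :: "'a set set \<Rightarrow> bool" where
  point: "non_evasive {{}, {v}}"
| step: "\<lbrakk>abstract_complex \<Sigma>; finite (vertices \<Sigma>); v \<in> vertices \<Sigma>; card (vertices \<Sigma>) > 1;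
          non_evasive (deletion \<Sigma> {v}); non_evasive (link \<Sigma> {v})\<rbrakk> \<Longrightarrow> non_evasive \<Sigma>"

definition order_complex :: "('a, 'b) gorder_scheme \<Rightarrow> 'a set set" where
  "order_complex P = {C. C \<subseteq> carrier P \<and> Complete_Partial_Order.chain (le P) C}"

definition has_meet :: "('a, 'b) gorder_scheme \<Rightarrow> 'a \<Rightarrow> 'a \<Rightarrow> bool" where
  "has_meet P x y \<longleftrightarrow> (\<exists>m. is_glb P m {x, y})"

definition has_join :: "('a, 'b) gorder_scheme \<Rightarrow> 'a \<Rightarrow> 'a \<Rightarrow> bool" where
  "has_join P x y \<longleftrightarrow> (\<exists>j. is_lub P j {x, y})"

lemma abstract_complex_order_complex: "abstract_complex (order_complex P)"
  unfolding abstract_complex_def order_complex_def Complete_Partial_Order.chain_def by blast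

lemma vertices_order_complex:
  assumes "partial_order P"
  shows "vertices (order_complex P) = carrier P"
proof -
  interpret partial_order P by fact
  show ?thesis
    by (auto simp: vertices_def order_complex_def Complete_Partial_Order.chain_def)
qed

end

theory Submission
  imports Defs
begin

text \<open>
  Call \<open>y\<close> good if \<open>s \<and> y\<close> exists. The good elements form a poset in which \<open>y \<mapsto> s \<and> y\<close> retracts
  everything below \<open>s\<close>, so their order complex is non-evasive. The other elements \<open>w\<close> are put back
  one at a time, each one being maximal among those present: above \<open>w\<close> there are then only good
  elements \<open>z\<close>, and \<open>z \<mapsto> z \<and> (w \<or> s)\<close> retracts these below \<open>w \<or> s\<close> (the value is again good,
  since its meet with \<open>s\<close> is \<open>s \<and> z\<close>, and hence differs from \<open>w\<close>). So the link of \<open>w\<close> is the join of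
  some complex with a non-evasive one.
\<close>

section \<open>Order complexes of subposets, their joins and cones\<close>

context partial_order
begin

text \<open>Only the carrier is replaced, so all subposets share the order of \<open>L\<close>, and
  deletions and links of vertices are again of this form, with a smaller \<open>Q\<close>.\<close>

abbreviation chains :: "'a set \<Rightarrow> 'a set set" where
  "chains Q \<equiv> order_complex (L\<lparr>carrier := Q\<rparr>)"

abbreviation comparable :: "'a \<Rightarrow> 'a \<Rightarrow> bool" where
  "comparable x y \<equiv> x \<sqsubseteq> y \<or> y \<sqsubseteq> x"

lemma vertices_chains:
  assumes "Q \<subseteq> carrier L"
  shows "vertices (chains Q) = Q"
  using assms by (auto simp: vertices_def order_complex_def Complete_Partial_Order.chain_def)

lemma deletion_chains:
  assumes "Q \<subseteq> carrier L"
  shows "deletion (chains Q) {v} = chains (Q - {v})"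
  unfolding deletion_def induced_def vertices_chains[OF assms]
  by (auto simp: order_complex_def)

lemma link_chains:
  assumes "Q \<subseteq> carrier L" "v \<in> Q"
  shows "link (chains Q) {v} = chains {q \<in> Q - {v}. comparable q v}"
  unfolding link_def deletion_chains[OF assms(1)] star_def
  using assms by (auto simp: order_complex_def Complete_Partial_Order.chain_def)

lemma non_evasive_chains_singleton:
  assumes "v \<in> carrier L"
  shows "non_evasive (chains {v})"
proof -
  have "chains {v} = {{}, {v}}"
    using assms by (auto simp: order_complex_def Complete_Partial_Order.chain_def)
  then show ?thesis
    by (simp add: non_evasive.point)
qed

text \<open>Neither introduction rule yields \<open>{{}}\<close>: it is not a point and has no
  vertex to remove.\<close>

lemma non_evasive_chains_nonempty:
  assumes "non_evasive (chains Q)"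
  shows "Q \<noteq> {}"
proof
  assume "Q = {}"
  then have "chains Q = {{}}"
    by (auto simp: order_complex_def Complete_Partial_Order.chain_def)
  with assms have "non_evasive {{} :: 'a set}"
    by simp
  then show False
    by cases (auto simp: vertices_def)
qed

text \<open>The bound on the number of vertices comes from the deletion: being non-evasive, it has a
  vertex, which differs from \<open>v\<close>.\<close>

lemma non_evasive_chains_step:
  assumes "finite Q" "Q \<subseteq> carrier L" "v \<in> Q"
    and "non_evasive (chains (Q - {v}))"
    and "non_evasive (chains {q \<in> Q - {v}. comparable q v})"
  shows "non_evasive (chains Q)"
proof (rule non_evasive.step[of _ v])
  have "card (Q - {v}) > 0"
    using non_evasive_chains_nonempty[OF assms(4)] assms(1) by (simp add: card_gt_0_iff)
  then show "card (vertices (chains Q)) > 1"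
    using assms(1-3) by (simp add: vertices_chains)
qed (use assms in \<open>simp_all add: vertices_chains deletion_chains link_chains
                               abstract_complex_order_complex\<close>)

text \<open>The complex is the simplicial join of \<open>chains A\<close> and
  \<open>chains B\<close>. Deletion and link of a vertex of \<open>A\<close> leave \<open>B\<close>
  intact and are joins of \<open>B\<close> with a smaller set; after finitely many removals only
  \<open>B\<close> remains.\<close>

lemma non_evasive_chains_join:
  assumes "finite A" "finite B" "A \<subseteq> carrier L" "B \<subseteq> carrier L" "A \<inter> B = {}"
    and "\<And>a b. a \<in> A \<Longrightarrow> b \<in> B \<Longrightarrow> comparable a b"
    and "non_evasive (chains B)"
  shows "non_evasive (chains (A \<union> B))"
  using assms(1,3,5,6)
proof (induction A rule: finite_psubset_induct)
  case (psubset A)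
  show ?case
  proof (cases "A = {}")
    case True
    then show ?thesis using assms(7) by simp
  next
    case False
    then obtain v where v: "v \<in> A" by blast
    have sub: "non_evasive (chains (A' \<union> B))" if "A' \<subset> A" for A'
      by (rule psubset.IH) (use that psubset.prems in blast)+
    have "A \<union> B - {v} = (A - {v}) \<union> B"
      and "{q \<in> A \<union> B - {v}. comparable q v} = {q \<in> A - {v}. comparable q v} \<union> B"
      using v psubset.prems by blast+
    moreover have "A - {v} \<subset> A" "{q \<in> A - {v}. comparable q v} \<subset> A"
      using v by blast+
    ultimately show ?thesis
      using v psubset.hyps psubset.prems(1) assms(2,4)
      by (intro non_evasive_chains_step[of "A \<union> B" v]) (simp_all add: sub)
  qed
qed

text \<open>A cone is the join of its base with the one-point complex on its apex.\<close>

lemma non_evasive_chains_cone: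
  assumes "finite Q" "Q \<subseteq> carrier L" "c \<in> Q" "\<And>q. q \<in> Q \<Longrightarrow> comparable q c"
  shows "non_evasive (chains Q)"
proof -
  have "non_evasive (chains ((Q - {c}) \<union> {c}))"
    using assms by (intro non_evasive_chains_join non_evasive_chains_singleton) auto
  then show ?thesis
    using assms(3) by (simp add: insert_absorb)
qed

section \<open>Extremal elements and retraction by meets\<close>

lemma asymp_on_less: "A \<subseteq> carrier L \<Longrightarrow> asymp_on A (\<lambda>x y. x \<sqsubset> y)"
  by (rule asymp_onI) (metis le_antisym lless_eq subsetD)

lemma transp_on_less: "A \<subseteq> carrier L \<Longrightarrow> transp_on A (\<lambda>x y. x \<sqsubset> y)"
  by (rule transp_onI) (erule (1) lless_trans; erule (1) subsetD)

lemma finite_minimal: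
  assumes "finite A" "A \<subseteq> carrier L" "A \<noteq> {}"
  obtains m where "m \<in> A" "\<And>x. x \<in> A \<Longrightarrow> x \<sqsubseteq> m \<Longrightarrow> x = m"
  using Finite_Set.bex_min_element[OF assms(1) asymp_on_less transp_on_less assms(3)] assms(2)
  by (auto simp: lless_eq)

lemma finite_maximal:
  assumes "finite A" "A \<subseteq> carrier L" "A \<noteq> {}"
  obtains m where "m \<in> A" "\<And>x. x \<in> A \<Longrightarrow> m \<sqsubseteq> x \<Longrightarrow> x = m"
  using Finite_Set.bex_max_element[OF assms(1) asymp_on_less transp_on_less assms(3)] assms(2)
  by (auto simp: lless_eq)

text \<open>
  A minimal \<open>x\<close> not below \<open>t\<close> can be deleted, because everything in its link is comparable to
  \<open>x \<and> t\<close>; this leaves a cone with apex \<open>t\<close> in the end.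
\<close>

lemma non_evasive_chains_meet_closed:
  assumes "finite Q" "Q \<subseteq> carrier L" "t \<in> Q"
    and "\<And>x. x \<in> Q \<Longrightarrow> \<exists>m\<in>Q. m \<sqsubseteq> x \<and> m \<sqsubseteq> t \<and> (\<forall>y\<in>Q. y \<sqsubseteq> x \<longrightarrow> y \<sqsubseteq> t \<longrightarrow> y \<sqsubseteq> m)"
  shows "non_evasive (chains Q)"
  using assms
proof (induction Q rule: finite_psubset_induct)
  case (psubset Q)
  show ?case
  proof (cases "\<forall>q\<in>Q. q \<sqsubseteq> t")
    case True
    then show ?thesis
      using psubset by (intro non_evasive_chains_cone[of _ t]) auto
  next
    case False
    then have "{q \<in> Q. \<not> q \<sqsubseteq> t} \<noteq> {}" by blast
    moreover have "finite {q \<in> Q. \<not> q \<sqsubseteq> t}" "{q \<in> Q. \<not> q \<sqsubseteq> t} \<subseteq> carrier L"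
      using psubset.hyps psubset.prems(1) by auto
    ultimately obtain x where "x \<in> {q \<in> Q. \<not> q \<sqsubseteq> t}"
      and min: "\<And>q. q \<in> {q \<in> Q. \<not> q \<sqsubseteq> t} \<Longrightarrow> q \<sqsubseteq> x \<Longrightarrow> q = x"
      using finite_minimal by blast
    then have x: "x \<in> Q" "\<not> x \<sqsubseteq> t" by auto
    obtain m where m: "m \<in> Q" "m \<sqsubseteq> x" "m \<sqsubseteq> t"
      and greatest: "\<And>y. y \<in> Q \<Longrightarrow> y \<sqsubseteq> x \<Longrightarrow> y \<sqsubseteq> t \<Longrightarrow> y \<sqsubseteq> m"
      using psubset.prems(3)[OF x(1)] by blast
    have "m \<noteq> x" using m x by blast
    \<comment> \<open>Meets with \<open>t\<close> are taken relative to \<open>Q\<close>. They lie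
      below \<open>t\<close>, unlike \<open>x\<close>, so all of them survive the removal of
      \<open>x\<close>.\<close>
    have "non_evasive (chains (Q - {x}))"
    proof (rule psubset.IH)
      show "t \<in> Q - {x}" using psubset.prems x by auto
      fix y assume "y \<in> Q - {x}"
      then show "\<exists>m\<in>Q - {x}. m \<sqsubseteq> y \<and> m \<sqsubseteq> t \<and> (\<forall>z\<in>Q - {x}. z \<sqsubseteq> y \<longrightarrow> z \<sqsubseteq> t \<longrightarrow> z \<sqsubseteq> m)"
        using psubset.prems(3)[of y] x(2) by blast
    qed (use x psubset.prems(1) in auto)
    moreover have "non_evasive (chains {q \<in> Q - {x}. comparable q x})"
    \<comment> \<open>The link is a cone with apex \<open>m\<close>: elements above \<open>x\<close>
      are above \<open>m\<close>, and those strictly below \<open>x\<close> are below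
      \<open>t\<close> by minimality of \<open>x\<close>, hence below \<open>m\<close>.\<close>
    proof (rule non_evasive_chains_cone[of _ m])
      fix q assume "q \<in> {q \<in> Q - {x}. comparable q x}"
      then have q: "q \<in> Q" "q \<noteq> x" "comparable q x" by auto
      show "comparable q m"
      proof (cases "q \<sqsubseteq> x")
        case True
        then have "q \<sqsubseteq> t" using min q by blast
        then show ?thesis using greatest True q by blast
      next
        case False
        then have "m \<sqsubseteq> q"
          using q m x psubset.prems(1) le_trans[of m x q] by blast
        then show ?thesis ..
      qed
    qed (use m \<open>m \<noteq> x\<close> psubset.hyps psubset.prems(1) in auto)
    ultimately show ?thesis
      using psubset.hyps psubset.prems(1) x(1) by (intro non_evasive_chains_step[of Q x])
  qed
qed

section \<open>Meets and joins of pairs\<close>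

lemma is_glb_pairD:
  assumes "is_glb L m {x, y}" "x \<in> carrier L" "y \<in> carrier L"
  shows "m \<in> carrier L" "m \<sqsubseteq> x" "m \<sqsubseteq> y"
    and "\<And>z. z \<in> carrier L \<Longrightarrow> z \<sqsubseteq> x \<Longrightarrow> z \<sqsubseteq> y \<Longrightarrow> z \<sqsubseteq> m"
  using assms by (auto simp: greatest_def Lower_def)

lemma is_glb_pairI:
  assumes "m \<in> carrier L" "m \<sqsubseteq> x" "m \<sqsubseteq> y" "x \<in> carrier L" "y \<in> carrier L"
    and "\<And>z. z \<in> carrier L \<Longrightarrow> z \<sqsubseteq> x \<Longrightarrow> z \<sqsubseteq> y \<Longrightarrow> z \<sqsubseteq> m"
  shows "is_glb L m {x, y}"
  using assms by (auto simp: greatest_def Lower_def)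

text \<open>The operation \<open>\<squnion>\<close> chooses a least upper bound, so existence has to
  be known first. The arguments are swapped to fit both \<open>has_join P s w\<close> and
  \<open>w \<squnion> s\<close> in the theorem.\<close>

lemma join_upper_bound:
  assumes "has_join L x y" "x \<in> carrier L" "y \<in> carrier L"
  shows "y \<squnion> x \<in> carrier L" "x \<sqsubseteq> y \<squnion> x" "y \<sqsubseteq> y \<squnion> x"
proof -
  have "is_lub L (y \<squnion> x) {y, x}"
    unfolding join_def sup_def
    by (rule someI_ex) (use assms(1) in \<open>simp add: has_join_def insert_commute\<close>)
  then show "y \<squnion> x \<in> carrier L" "x \<sqsubseteq> y \<squnion> x" "y \<sqsubseteq> y \<squnion> x"
    using assms(2,3) by (auto simp: least_def Upper_def)
qed

end

theorem theorem8:
  fixes P :: "('a, 'b) gorder_scheme" (structure) and s :: 'a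
  assumes "partial_order P"
    and "finite (carrier P)"
    and "s \<in> carrier P"
    and "\<And>y. y \<in> carrier P \<Longrightarrow> has_meet P s y \<or> has_join P s y"
    and "\<And>w z. \<lbrakk>w \<in> carrier P; z \<in> carrier P; w \<sqsubset> z; \<not> has_meet P s w; has_meet P s z\<rbrakk>
           \<Longrightarrow> has_meet P z (w \<squnion> s)"
  shows "non_evasive (order_complex P)"
proof -
  interpret partial_order P by fact
  define M where "M = {y \<in> carrier P. has_meet P s y}"
  have M_carrier: "M \<subseteq> carrier P" and "finite M"
    using assms(2) by (auto simp: M_def)
  \<comment> \<open>Two comparable elements have the smaller one as their meet. Thus
    \<open>M\<close> contains \<open>s\<close> and, for each \<open>x\<close> in \<open>M\<close>,
    the meet of \<open>s\<close> and \<open>x\<close>.\<close>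
  have le_s_M: "y \<in> M" if "y \<in> carrier P" "y \<sqsubseteq> s" for y
    using that assms(3) is_glb_pairI[of y s y] by (auto simp: M_def has_meet_def)
  have ge_s_M: "y \<in> M" if "y \<in> carrier P" "s \<sqsubseteq> y" for y
    using that assms(3) is_glb_pairI[of s s y] by (auto simp: M_def has_meet_def)

  have NE_M: "non_evasive (chains M)"
  proof (rule non_evasive_chains_meet_closed[of M s])
    fix x assume "x \<in> M"
    then obtain m where x: "x \<in> carrier P" and m: "is_glb P m {s, x}"
      by (auto simp: M_def has_meet_def)
    note glb = is_glb_pairD[OF m assms(3) x]
    show "\<exists>m\<in>M. m \<sqsubseteq> x \<and> m \<sqsubseteq> s \<and> (\<forall>y\<in>M. y \<sqsubseteq> x \<longrightarrow> y \<sqsubseteq> s \<longrightarrow> y \<sqsubseteq> m)"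
      using glb(2,3) M_carrier by (intro bexI[OF _ le_s_M[OF glb(1,2)]]) (simp add: glb(4) subset_iff)
  qed (use M_carrier \<open>finite M\<close> le_s_M[of s] assms(3) in auto)

  have NE_above: "non_evasive (chains {z \<in> M. w \<sqsubseteq> z})" if w: "w \<in> carrier P" "w \<notin> M" for w
  proof -
    let ?j = "w \<squnion> s"
    have "has_join P s w"
      using assms(4) w by (auto simp: M_def)
    note j = join_upper_bound[OF this assms(3) w(1)]
    show ?thesis
    \<comment> \<open>The join \<open>?j\<close> is itself in \<open>M\<close>, being above
      \<open>s\<close>. What remains is that the meet of \<open>z\<close> and \<open>?j\<close>
      stays in \<open>M\<close> and above \<open>w\<close>.\<close>
    proof (rule non_evasive_chains_meet_closed[of _ ?j])
      fix z assume "z \<in> {z \<in> M. w \<sqsubseteq> z}"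
      then have z: "z \<in> M" "z \<in> carrier P" "w \<sqsubseteq> z" using M_carrier by auto
      then have "w \<sqsubset> z" using w by (auto simp: lless_def eq_is_equal)
      then obtain m where m: "is_glb P m {z, ?j}"
        using assms(5)[of w z] w z by (auto simp: M_def has_meet_def)
      note glb = is_glb_pairD[OF m z(2) j(1)]
      obtain n where n: "is_glb P n {s, z}"
        using z by (auto simp: M_def has_meet_def)
      note glb' = is_glb_pairD[OF n assms(3) z(2)]
      \<comment> \<open>Since \<open>s \<sqsubseteq> ?j\<close> and \<open>m\<close> is the meet of
        \<open>z\<close> and \<open>?j\<close>, the common lower bounds of \<open>s\<close> and
        \<open>m\<close> are those of \<open>s\<close> and \<open>z\<close>.\<close>
      have "is_glb P n {s, m}"
      proof (rule is_glb_pairI)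
        show "n \<sqsubseteq> m"
          using glb' glb(4) j le_trans[of n s ?j] assms(3) by blast
        show "y \<sqsubseteq> n" if "y \<in> carrier P" "y \<sqsubseteq> s" "y \<sqsubseteq> m" for y
          using that glb' glb(1,2) z le_trans[of y m z] by blast
      qed (use glb glb' assms(3) in auto)
      then have "m \<in> M"
        using glb(1) by (auto simp: M_def has_meet_def)
      moreover have "w \<sqsubseteq> m"
        using glb(4) w z j by blast
      ultimately show "\<exists>m\<in>{z \<in> M. w \<sqsubseteq> z}. m \<sqsubseteq> z \<and> m \<sqsubseteq> ?j \<and>
          (\<forall>y\<in>{z \<in> M. w \<sqsubseteq> z}. y \<sqsubseteq> z \<longrightarrow> y \<sqsubseteq> ?j \<longrightarrow> y \<sqsubseteq> m)"
        using glb(2,3) M_carrier by (intro bexI[of _ m]) (simp_all add: glb(4) subset_iff)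
    qed (use M_carrier \<open>finite M\<close> ge_s_M[of ?j] j in auto)
  qed

  \<comment> \<open>Stated for arbitrary \<open>D\<close> to allow induction; the whole poset is the
    case \<open>D = carrier P - M\<close>.\<close>
  have NE_Un: "non_evasive (chains (M \<union> D))" if "finite D" "D \<subseteq> carrier P - M" for D
    using that
  proof (induction D rule: finite_psubset_induct)
    case (psubset D)
    show ?case
    proof (cases "D = {}")
      case True
      then show ?thesis using NE_M by simp
    next
      case False
      then obtain w where w: "w \<in> D" and max: "\<And>x. x \<in> D \<Longrightarrow> w \<sqsubseteq> x \<Longrightarrow> x = w"
        using finite_maximal[of D] psubset.hyps psubset.prems by auto
      have w': "w \<in> carrier P" "w \<notin> M" using w psubset.prems by auto
      have "non_evasive (chains (M \<union> (D - {w})))"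
        using w psubset.prems by (intro psubset.IH) auto
      then have "non_evasive (chains (M \<union> D - {w}))"
        using w' by (simp add: Un_Diff)
      moreover have "non_evasive (chains {q \<in> M \<union> D - {w}. comparable q w})"
      proof -
        \<comment> \<open>The link of \<open>w\<close> splits into the parts below and above
          \<open>w\<close>, comparable through \<open>w\<close>. By maximality of \<open>w\<close>
          in \<open>D\<close>, the upper part lies in \<open>M\<close>, so it is \<open>?B\<close>,
          which is non-evasive by \<open>NE_above\<close>.\<close>
        let ?A = "{q \<in> M \<union> D - {w}. q \<sqsubseteq> w}" and ?B = "{z \<in> M. w \<sqsubseteq> z}"
        have "non_evasive (chains (?A \<union> ?B))"
        proof (rule non_evasive_chains_join)
          show "?A \<inter> ?B = {}"
            using w' M_carrier by (auto dest: le_antisym)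
          show "comparable a b" if "a \<in> ?A" "b \<in> ?B" for a b
          proof -
            have "a \<sqsubseteq> b"
              by (rule le_trans[of a w b]) (use that w' M_carrier psubset.prems in auto)
            then show ?thesis ..
          qed
        qed (use NE_above[OF w'] M_carrier \<open>finite M\<close> psubset.hyps psubset.prems in auto)
        also have "?A \<union> ?B = {q \<in> M \<union> D - {w}. comparable q w}"
          using max w' by blast
        finally show ?thesis .
      qed
      ultimately show ?thesis
        using w M_carrier \<open>finite M\<close> psubset.hyps psubset.prems
        by (intro non_evasive_chains_step[of "M \<union> D" w]) auto
    qed
  qed
  have "M \<union> (carrier P - M) = carrier P"
    using M_carrier by blast
  then show ?thesis
    using NE_Un[of "carrier P - M"] assms(2) by simp
qed

end
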